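(* Let $\mathbb{F}$ be a field, $d\ge3$, $V$ a vector space over $\mathbb{F}$ of dimension $d+1$, and $\Phi=(A;\{E_i\}_{i=0}^d;A^*;\{E^*_i\}_{i=0}^d)$ a CH system on $V$ with eigenvalue sequence $\{\theta_i\}_{i=0}^d$, dual eigenvalue sequence $\{\theta^*_i\}_{i=0}^d$ and $\Phi$-split sequence $\{\phi_i\}_{i=1}^d$. Fix a nonzero vector $u^*\in E^*_0V$ and for $0\le i\le d$ let $v_i=(A-\theta_{d-i+1}I)\cdots(A-\theta_{d-1}I)(A-\theta_dI)u^*$. Then with respect to the basis $\{v_{d-i}\}_{i=0}^d$ of $V$: the matrix representing $A$ is upper bidiagonal with $(i,i)$-entry $\theta_i$ $(0\le i\le d)$, $(i-1,i)$-entry $1$ $(1\le i\le d)$ and all other entries $0$; and the matrix representing $A^*$ is lower bidiagonal with $(i,i)$-entry $\theta^*_{d-i}$ $(0\le i\le d)$, $(i,i-1)$-entry $\phi_{d-i+1}$ $(1\le i\le d)$ and all other entries $0$.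
   Context: Rows and columns of $(d+1)\times(d+1)$ matrices are indexed by $0,\dots,d$. A matrix $M$ represents $B\in\mathrm{End}(V)$ with respect to a basis $\{w_i\}_{i=0}^d$ if $Bw_j=\sum_iM_{ij}w_i$. An element of $\mathrm{End}(V)$ is multiplicity-free if it is diagonalizable with all eigenspaces of dimension one. The primitive idempotent of a multiplicity-free $B$ for an eigenvalue $\theta$ is the $E\in\mathrm{End}(V)$ acting as the identity on the $\theta$-eigenspace and as $0$ on the other eigenspaces. A CH system on $V$ is a sequence $\Phi=(A;\{E_i\}_{i=0}^d;A^*;\{E^*_i\}_{i=0}^d)$ in $\mathrm{End}(V)$ such that: (i) $A,A^*$ are multiplicity-free; (ii) $\{E_i\}$ is an ordering of the primitive idempotents of $A$; (iii) $\{E^*_i\}$ is an ordering of the primitive idempotents of $A^*$; (iv) $E_iA^*E_j=0$ if $1<i-j$ or $1<j-i<d$, and $E_iA^*E_j\neq0$ if $i-j=1$ or $j-i=d$; (v) $E^*_iAE^*_j=0$ if $1<i-j$ or $1<j-i<d$, and $E^*_iAE^*_j\neq0$ if $i-j=1$ or $j-i=d$ $(0\le i,j\le d)$. $\theta_i$ (resp. $\theta^*_i$) is the eigenvalue of $A$ (resp. $A^*$) corresponding to $E_i$ (resp. $E^*_i$). It is known that there is a unique sequence $\{\phi_i\}_{i=1}^d$ of nonzero scalars (the $\Phi$-split sequence) such that for some basis of $V$, $A$ is represented by the lower bidiagonal matrix with $(i,i)$-entry $\theta_{d-i}$ and $(i,i-1)$-entry $1$, and $A^*$ by the upper bidiagonal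 matrix with $(i,i)$-entry $\theta^*_i$ and $(i-1,i)$-entry $\phi_i$ (all other entries $0$). It is known that $\{v_i\}_{i=0}^d$ is a basis of $V$. *)

theory Defs
  imports "Jordan_Normal_Form.Matrix"
begin

text \<open>
  The vector space \<open>V\<close> is the whole type \<open>'b\<close> with scalar multiplication \<open>scale\<close>; an element of
  \<open>End(V)\<close> is a function \<open>'b \<Rightarrow> 'b\<close> that is linear. A sequence with index set \<open>0,\<dots>,d\<close>
  (or \<open>1,\<dots>,d\<close>) is a function on \<open>nat\<close> whose values elsewhere are irrelevant.
\<close>

text \<open>
  In both matrices the off-diagonal sequence is indexed by \<open>1,\<dots>,d\<close>: the argument \<open>b i\<close> is the
  \<open>(i, i - 1)\<close>-entry of the lower and the \<open>(i - 1, i)\<close>-entry of the upper bidiagonal matrix.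
\<close>

definition lower_bidiagonal :: "nat \<Rightarrow> (nat \<Rightarrow> 'a::zero) \<Rightarrow> (nat \<Rightarrow> 'a) \<Rightarrow> 'a mat" where
  "lower_bidiagonal d a b =
     mat (d + 1) (d + 1) (\<lambda>(i, j). if i = j then a i else if i = j + 1 then b i else 0)"

definition upper_bidiagonal :: "nat \<Rightarrow> (nat \<Rightarrow> 'a::zero) \<Rightarrow> (nat \<Rightarrow> 'a) \<Rightarrow> 'a mat" where
  "upper_bidiagonal d a b =
     mat (d + 1) (d + 1) (\<lambda>(i, j). if i = j then a i else if j = i + 1 then b j else 0)"

context
  fixes scale :: "'a::field \<Rightarrow> 'b::ab_group_add \<Rightarrow> 'b"
begin

definition eigenspace :: "('b \<Rightarrow> 'b) \<Rightarrow> 'a \<Rightarrow> 'b set" where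
  "eigenspace B t = {x. B x = scale t x}"

definition is_eigenvalue :: "('b \<Rightarrow> 'b) \<Rightarrow> 'a \<Rightarrow> bool" where
  "is_eigenvalue B t \<longleftrightarrow> (\<exists>x. x \<noteq> 0 \<and> x \<in> eigenspace B t)"

definition diagonalizable :: "('b \<Rightarrow> 'b) \<Rightarrow> bool" where
  "diagonalizable B \<longleftrightarrow>
     (\<exists>S. \<not> module.dependent scale S \<and> module.span scale S = UNIV \<and> (\<forall>x\<in>S. \<exists>t. x \<in> eigenspace B t))"

definition multiplicity_free :: "('b \<Rightarrow> 'b) \<Rightarrow> bool" where
  "multiplicity_free B \<longleftrightarrow>
     diagonalizable B \<and> (\<forall>t. is_eigenvalue B t \<longrightarrow> vector_space.dim scale (eigenspace B t) = 1)"

definition primitive_idempotent :: "('b \<Rightarrow> 'b) \<Rightarrow> 'a \<Rightarrow> ('b \<Rightarrow> 'b) \<Rightarrow> bool" where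
  "primitive_idempotent B t P \<longleftrightarrow>
     is_eigenvalue B t \<and> Vector_Spaces.linear scale scale P \<and>
     (\<forall>x\<in>eigenspace B t. P x = x) \<and>
     (\<forall>s. s \<noteq> t \<longrightarrow> (\<forall>x\<in>eigenspace B s. P x = 0))"

definition orders_primitive_idempotents ::
    "nat \<Rightarrow> ('b \<Rightarrow> 'b) \<Rightarrow> (nat \<Rightarrow> 'b \<Rightarrow> 'b) \<Rightarrow> bool" where
  "orders_primitive_idempotents d B E \<longleftrightarrow>
     bij_betw E {0..d} {P. \<exists>t. primitive_idempotent B t P}"

text \<open>
  The index conditions \<open>1 < i - j\<close>, \<open>1 < j - i < d\<close>, \<open>i - j = 1\<close> and \<open>j - i = d\<close> concern integers;
  they are stated additively to avoid truncated subtraction.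
\<close>

definition CH_pattern :: "nat \<Rightarrow> (nat \<Rightarrow> 'b \<Rightarrow> 'b) \<Rightarrow> ('b \<Rightarrow> 'b) \<Rightarrow> bool" where
  "CH_pattern d E B \<longleftrightarrow>
     (\<forall>i\<le>d. \<forall>j\<le>d.
        (j + 1 < i \<or> (i + 1 < j \<and> j < i + d) \<longrightarrow> E i \<circ> B \<circ> E j = (\<lambda>x. 0)) \<and>
        (i = j + 1 \<or> j = i + d \<longrightarrow> E i \<circ> B \<circ> E j \<noteq> (\<lambda>x. 0)))"

definition CH_system ::
    "nat \<Rightarrow> ('b \<Rightarrow> 'b) \<Rightarrow> (nat \<Rightarrow> 'b \<Rightarrow> 'b) \<Rightarrow> ('b \<Rightarrow> 'b) \<Rightarrow> (nat \<Rightarrow> 'b \<Rightarrow> 'b) \<Rightarrow> bool" where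
  "CH_system d A E As Es \<longleftrightarrow>
     Vector_Spaces.linear scale scale A \<and> Vector_Spaces.linear scale scale As \<and>
     multiplicity_free A \<and> multiplicity_free As \<and>
     orders_primitive_idempotents d A E \<and>
     orders_primitive_idempotents d As Es \<and>
     CH_pattern d E As \<and>
     CH_pattern d Es A"

definition eigenvalue_sequence ::
    "nat \<Rightarrow> ('b \<Rightarrow> 'b) \<Rightarrow> (nat \<Rightarrow> 'b \<Rightarrow> 'b) \<Rightarrow> (nat \<Rightarrow> 'a) \<Rightarrow> bool" where
  "eigenvalue_sequence d B E \<theta> \<longleftrightarrow> (\<forall>i\<le>d. primitive_idempotent B (\<theta> i) (E i))"

definition is_basis :: "nat \<Rightarrow> (nat \<Rightarrow> 'b) \<Rightarrow> bool" where
  "is_basis d w \<longleftrightarrow>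
     inj_on w {0..d} \<and> \<not> module.dependent scale (w ` {0..d}) \<and> module.span scale (w ` {0..d}) = UNIV"

definition represents :: "nat \<Rightarrow> 'a mat \<Rightarrow> ('b \<Rightarrow> 'b) \<Rightarrow> (nat \<Rightarrow> 'b) \<Rightarrow> bool" where
  "represents d M B w \<longleftrightarrow>
     M \<in> carrier_mat (d + 1) (d + 1) \<and>
     (\<forall>j\<le>d. B (w j) = (\<Sum>i=0..d. scale (M $$ (i, j)) (w i)))"

text \<open>
  For a CH system there is exactly one \<open>\<phi>\<close> on \<open>1,\<dots>,d\<close> with this property; \<open>\<theta>\<close> and
  \<open>\<theta>s\<close> are its eigenvalue and dual eigenvalue sequences.
\<close>

definition split_sequence ::
    "nat \<Rightarrow> ('b \<Rightarrow> 'b) \<Rightarrow> ('b \<Rightarrow> 'b) \<Rightarrow> (nat \<Rightarrow> 'a) \<Rightarrow> (nat \<Rightarrow> 'a) \<Rightarrow> (nat \<Rightarrow> 'a) \<Rightarrow> bool" where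
  "split_sequence d A As \<theta> \<theta>s \<phi> \<longleftrightarrow>
     (\<forall>i\<in>{1..d}. \<phi> i \<noteq> 0) \<and>
     (\<exists>w. is_basis d w \<and>
          represents d (lower_bidiagonal d (\<lambda>i. \<theta> (d - i)) (\<lambda>i. 1)) A w \<and>
          represents d (upper_bidiagonal d \<theta>s \<phi>) As w)"

text \<open>
  \<open>(A - \<theta>\<^bsub>d-i+1\<^esub> I) \<cdots> (A - \<theta>\<^bsub>d-1\<^esub> I) (A - \<theta>\<^bsub>d\<^esub> I) u\<close> for \<open>i \<le> d\<close>; the factor
  for \<open>\<theta>\<^bsub>d\<^esub>\<close> is applied first.
\<close>

definition split_vector :: "nat \<Rightarrow> ('b \<Rightarrow> 'b) \<Rightarrow> (nat \<Rightarrow> 'a) \<Rightarrow> 'b \<Rightarrow> nat \<Rightarrow> 'b" where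
  "split_vector d A \<theta> u i = foldr (\<lambda>k x. A x - scale (\<theta> k) x) [d - i + 1..<d + 1] u"

end

end

theory Submission
  imports Defs
begin

text \<open>
  In the split basis \<open>w\<close> both \<open>w 0\<close> and \<open>us\<close> lie in the one-dimensional eigenspace of \<open>As\<close> for
  \<open>\<theta>s 0\<close>, so \<open>us = c w 0\<close> with \<open>c \<noteq> 0\<close>. As \<open>(A - \<theta> (d - i) I) (w i) = w (i + 1)\<close>, the split
  vectors are \<open>v i = c w i\<close>: reversing the split basis reverses both bidiagonal matrices.
\<close>

context vector_space
begin

text \<open>Turns the matrix condition into a recurrence along the basis, so that the main proof can
  work with vectors and never expand a sum over matrix entries.\<close>

lemma represents_upper_bidiagonal_iff:
  "represents scale d (upper_bidiagonal d a b) B w \<longleftrightarrow>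
     (\<forall>j\<le>d. B (w j) = scale (a j) (w j) + (if j = 0 then 0 else scale (b j) (w (j - 1))))"
proof -
  have "(\<Sum>i=0..d. scale (upper_bidiagonal d a b $$ (i, j)) (w i))
      = scale (a j) (w j) + (if j = 0 then 0 else scale (b j) (w (j - 1)))" if "j \<le> d" for j
  proof -
    \<comment> \<open>Each summand splits into two Kronecker deltas. At \<open>j = 0\<close>
      truncated subtraction makes both select \<open>i = 0\<close>, so the second one needs its
      inner case split to vanish there.\<close>
    have "(\<Sum>i=0..d. scale (upper_bidiagonal d a b $$ (i, j)) (w i))
        = (\<Sum>i=0..d. (if i = j then scale (a j) (w j) else 0) +
            (if i = j - 1 then (if j = 0 then 0 else scale (b j) (w (j - 1))) else 0))"
      using that by (intro sum.cong) (auto simp: upper_bidiagonal_def)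
    also have "\<dots> = scale (a j) (w j) + (if j = 0 then 0 else scale (b j) (w (j - 1)))"
      using that by (subst sum.distrib) auto
    finally show ?thesis .
  qed
  then show ?thesis
    by (simp add: represents_def upper_bidiagonal_def)
qed

lemma represents_lower_bidiagonal_iff:
  "represents scale d (lower_bidiagonal d a b) B w \<longleftrightarrow>
     (\<forall>j\<le>d. B (w j) = scale (a j) (w j) + (if j < d then scale (b (j + 1)) (w (j + 1)) else 0))"
proof -
  have "(\<Sum>i=0..d. scale (lower_bidiagonal d a b $$ (i, j)) (w i))
      = scale (a j) (w j) + (if j < d then scale (b (j + 1)) (w (j + 1)) else 0)" if "j \<le> d" for j
  proof -
    \<comment> \<open>For \<open>j = d\<close> the index \<open>j + 1\<close> lies outside the range
      of summation; this is where the guard \<open>j < d\<close> comes from.\<close>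
    have "(\<Sum>i=0..d. scale (lower_bidiagonal d a b $$ (i, j)) (w i))
        = (\<Sum>i=0..d. (if i = j then scale (a j) (w j) else 0) +
            (if i = j + 1 then scale (b (j + 1)) (w (j + 1)) else 0))"
      using that by (intro sum.cong) (auto simp: lower_bidiagonal_def)
    also have "\<dots> = scale (a j) (w j) + (if j < d then scale (b (j + 1)) (w (j + 1)) else 0)"
      using that by (subst sum.distrib) auto
    finally show ?thesis .
  qed
  then show ?thesis
    by (simp add: represents_def lower_bidiagonal_def)
qed

lemma subspace_eigenspace:
  assumes "Vector_Spaces.linear scale scale B"
  shows "subspace (eigenspace scale B t)"
proof -
  interpret B: Vector_Spaces.linear scale scale B by fact
  show ?thesis
    by (auto simp: subspace_def eigenspace_def B.zero B.add B.scale scale_right_distrib mult.commute)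
qed

text \<open>The definition prescribes \<open>P\<close> on eigenvectors only. These span the space,
  and \<open>P\<close> sends each of them to itself or to 0, in both cases into the subspace for
  \<open>t\<close>; linearity extends this to all vectors.\<close>

lemma range_primitive_idempotent_subset:
  assumes B: "Vector_Spaces.linear scale scale B" and "diagonalizable scale B"
    and P: "primitive_idempotent scale B t P"
  shows "range P \<subseteq> eigenspace scale B t"
proof -
  obtain S where span_S: "span S = UNIV" and eigenvectors: "\<forall>x\<in>S. \<exists>s. x \<in> eigenspace scale B s"
    using assms(2) unfolding diagonalizable_def by blast
  interpret P: Vector_Spaces.linear scale scale P
    using P by (simp add: primitive_idempotent_def)
  note subsp = subspace_eigenspace[OF B, of t]
  have "P x \<in> eigenspace scale B t" if x: "x \<in> S" for x
  proof -
    obtain s where s: "x \<in> eigenspace scale B s"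
      using eigenvectors x by blast
    show ?thesis
      using P s subspace_0[OF subsp] by (cases "s = t") (auto simp: primitive_idempotent_def)
  qed
  then have "span (P ` S) \<subseteq> eigenspace scale B t"
    by (intro span_minimal subsp) auto
  then show ?thesis
    by (simp add: P.span_image span_S)
qed

lemma dim_eq_1_imp_scale:
  assumes "dim X = 1" "x \<in> X" "y \<in> X" "x \<noteq> 0" "y \<noteq> 0"
  obtains c where "c \<noteq> 0" "y = scale c x"
proof -
  obtain B where B: "X \<subseteq> span B" "card B = 1"
    using basis_exists[of X] assms(1) by metis
  then obtain b where b: "X \<subseteq> span {b}"
    by (auto simp: card_1_singleton_iff)
  then obtain k l where k: "x = scale k b" and l: "y = scale l b"
    using assms(2,3) unfolding span_singleton by blast
  show ?thesis
    \<comment> \<open>Both \<open>k\<close> and \<open>l\<close> are nonzero because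
      \<open>x\<close> and \<open>y\<close> are.\<close>
    by (rule that[of "l / k"]) (use assms(4,5) k l in auto)
qed

text \<open>Multiplication by a nonzero scalar is a linear bijection, hence preserves independence
  and spanning.\<close>

lemma is_basis_scale:
  assumes "is_basis scale d w" "c \<noteq> 0"
  shows "is_basis scale d (\<lambda>i. scale c (w i))"
proof -
  interpret vector_space_pair scale scale ..
  interpret c: Vector_Spaces.linear scale scale "scale c"
    by (rule linear_scale_self)
  have inj: "inj (scale c)"
    using assms(2) by (auto intro: injI)
  have surj: "surj (scale c)"
    by (rule surjI[of _ "scale (inverse c)"]) (use assms(2) in simp)
  have image: "(\<lambda>i. scale c (w i)) ` {0..d} = scale c ` (w ` {0..d})"
    by (simp add: image_image)
  have "inj_on (scale c) (span (w ` {0..d}))"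
    using inj by (rule inj_on_subset) simp
  then have "\<not> dependent (scale c ` w ` {0..d})"
    using assms(1) c.linear_axioms by (simp add: is_basis_def linear_independent_injective_image)
  moreover have "span (scale c ` w ` {0..d}) = UNIV"
    using assms(1) surj by (simp add: is_basis_def c.span_image)
  moreover have "inj_on (\<lambda>i. scale c (w i)) {0..d}"
    using assms by (simp add: is_basis_def inj_on_def)
  ultimately show ?thesis
    by (simp add: is_basis_def image)
qed

lemma is_basis_rev:
  assumes "is_basis scale d w"
  shows "is_basis scale d (\<lambda>i. w (d - i))"
proof -
  have rev: "bij_betw (\<lambda>i. d - i) {0..d} {0..d}"
    by (rule bij_betwI[where g = "\<lambda>i. d - i"]) auto
  have "(\<lambda>i. w (d - i)) ` {0..d} = w ` ((\<lambda>i. d - i) ` {0..d})"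
    by (simp add: image_image)
  also have "\<dots> = w ` {0..d}"
    using rev by (simp add: bij_betw_def)
  finally have "(\<lambda>i. w (d - i)) ` {0..d} = w ` {0..d}" .
  moreover have "inj_on (\<lambda>i. w (d - i)) {0..d}"
    using comp_inj_on[of "\<lambda>i. d - i" "{0..d}" w] rev assms
    by (simp add: bij_betw_def is_basis_def comp_def)
  ultimately show ?thesis
    using assms by (simp add: is_basis_def)
qed

lemma is_basis_nonzero: "is_basis scale d w \<Longrightarrow> i \<le> d \<Longrightarrow> w i \<noteq> 0"
  unfolding is_basis_def by (metis atLeastAtMost_iff dependent_zero imageI zero_le)

end

lemma split_vector_0: "split_vector scale d A \<theta> u 0 = u"
  by (simp add: split_vector_def)

text \<open>The list of indices grows at its head, and \<open>foldr\<close> applies the head last,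
  so the new factor acts on the previous split vector. The assumption \<open>i < d\<close> makes
  \<open>d - Suc i + 1\<close> equal to \<open>d - i\<close>.\<close>

lemma split_vector_Suc:
  assumes "i < d"
  shows "split_vector scale d A \<theta> u (Suc i)
    = A (split_vector scale d A \<theta> u i) - scale (\<theta> (d - i)) (split_vector scale d A \<theta> u i)"
proof -
  have "[d - Suc i + 1..<d + 1] = (d - i) # [d - i + 1..<d + 1]"
    using assms by (simp add: Suc_diff_Suc upt_rec[of "d - i"] del: upt_Suc)
  then show ?thesis
    by (simp add: split_vector_def del: upt_Suc)
qed

theorem lemma6p9:
  fixes scale :: "'f::field \<Rightarrow> 'v::ab_group_add \<Rightarrow> 'v"
    and d :: nat
    and A As :: "'v \<Rightarrow> 'v"
    and E Es :: "nat \<Rightarrow> 'v \<Rightarrow> 'v"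
    and \<theta> \<theta>s \<phi> :: "nat \<Rightarrow> 'f"
    and us :: 'v
    and v :: "nat \<Rightarrow> 'v"
  assumes "vector_space scale"
    and "d \<ge> 3"
    and "vector_space.dim scale (UNIV :: 'v set) = d + 1"
    and "CH_system scale d A E As Es"
    and "eigenvalue_sequence scale d A E \<theta>"
    and "eigenvalue_sequence scale d As Es \<theta>s"
    and "split_sequence scale d A As \<theta> \<theta>s \<phi>"
    and "us \<noteq> 0"
    and "us \<in> range (Es 0)"
    and "\<And>i. i \<le> d \<Longrightarrow> v i = split_vector scale d A \<theta> us i"
  shows "is_basis scale d (\<lambda>i. v (d - i)) \<and>
    represents scale d (upper_bidiagonal d \<theta> (\<lambda>i. 1)) A (\<lambda>i. v (d - i)) \<and>
    represents scale d
      (lower_bidiagonal d (\<lambda>i. \<theta>s (d - i)) (\<lambda>i. \<phi> (d - i + 1))) As (\<lambda>i. v (d - i))"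
proof -
  interpret vector_space scale by fact
  obtain w where w: "is_basis scale d w"
    and "represents scale d (lower_bidiagonal d (\<lambda>i. \<theta> (d - i)) (\<lambda>i. 1)) A w"
    and "represents scale d (upper_bidiagonal d \<theta>s \<phi>) As w"
    using assms(7) unfolding split_sequence_def by blast
  then have A_w: "A (w j) = scale (\<theta> (d - j)) (w j) + (if j < d then w (j + 1) else 0)"
    and As_w: "As (w j) = scale (\<theta>s j) (w j) + (if j = 0 then 0 else scale (\<phi> j) (w (j - 1)))"
    if "j \<le> d" for j
    using that unfolding represents_lower_bidiagonal_iff represents_upper_bidiagonal_iff by auto
  have A: "Vector_Spaces.linear scale scale A" and As: "Vector_Spaces.linear scale scale As"
    and mf: "multiplicity_free scale As"
    using assms(4) unfolding CH_system_def by auto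
  interpret A: Vector_Spaces.linear scale scale A by fact
  interpret As: Vector_Spaces.linear scale scale As by fact
  have idem: "primitive_idempotent scale As (\<theta>s 0) (Es 0)"
    using assms(6) by (simp add: eigenvalue_sequence_def)
  have "dim (eigenspace scale As (\<theta>s 0)) = 1"
    using mf idem by (simp add: multiplicity_free_def primitive_idempotent_def)
  \<comment> \<open>Column 0 of an upper bidiagonal matrix has only its diagonal entry.\<close>
  moreover have "w 0 \<in> eigenspace scale As (\<theta>s 0)"
    using As_w[of 0] by (simp add: eigenspace_def)
  moreover have "us \<in> eigenspace scale As (\<theta>s 0)"
    using range_primitive_idempotent_subset[OF As _ idem] mf assms(9)
    by (auto simp: multiplicity_free_def)
  ultimately obtain c where c: "c \<noteq> 0" "us = scale c (w 0)"
    using dim_eq_1_imp_scale is_basis_nonzero[OF w] assms(8) by (metis zero_le)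
  have split: "split_vector scale d A \<theta> us i = scale c (w i)" if "i \<le> d" for i
    using that
  proof (induction i)
    case 0
    show ?case by (simp add: split_vector_0 c)
  next
    case (Suc i)
    then show ?case
      by (simp add: split_vector_Suc A.scale A_w scale_right_distrib mult.commute)
  qed
  then have v: "v i = scale c (w i)" if "i \<le> d" for i
    using assms(10) that by simp
  have "is_basis scale d (\<lambda>i. scale c (w (d - i)))"
    by (intro is_basis_scale is_basis_rev w c)
  then have "is_basis scale d (\<lambda>i. v (d - i))"
    by (simp add: v)
  \<comment> \<open>At \<open>d - j\<close> the relation \<open>A_w\<close> has eigenvalue
    \<open>\<theta> (d - (d - j)) = \<theta> j\<close>, and its successor
    \<open>w (d - j + 1)\<close> is the predecessor in the reversed order; the guard
    \<open>d - j < d\<close> becomes \<open>j > 0\<close>.\<close>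
  moreover have "represents scale d (upper_bidiagonal d \<theta> (\<lambda>i. 1)) A (\<lambda>i. v (d - i))"
    unfolding represents_upper_bidiagonal_iff
    by (auto simp: v A.scale A_w scale_right_distrib mult.commute Suc_diff_le)
  \<comment> \<open>For \<open>j < d\<close> the subdiagonal entry of column \<open>j\<close> is
    \<open>\<phi> (d - (j + 1) + 1) = \<phi> (d - j)\<close>, the coefficient that
    \<open>As_w\<close> gives at \<open>d - j\<close>.\<close>
  moreover have "represents scale d
      (lower_bidiagonal d (\<lambda>i. \<theta>s (d - i)) (\<lambda>i. \<phi> (d - i + 1))) As (\<lambda>i. v (d - i))"
    unfolding represents_lower_bidiagonal_iff
    by (auto simp: v As.scale As_w scale_right_distrib mult.commute Suc_diff_Suc)
  ultimately show ?thesis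
    by blast
qed

end
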